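(* Let $(\bar r_k)_{k=1}^\infty$ be a sequence of $n$-tuples $\bar r_k=(r_k^{(1)},\ldots,r_k^{(n)})$ of positive numbers that decays $(X,\rho,H,L,\mathbf F)$-fast, and let $f\in C(X)$. Suppose $\bar x=(x^{(1)},\ldots,x^{(n)})$ is an $n$-tuple in $X$ such that $$C_h=\lim_{k\to\infty}\operatorname{Avg}_{F_k}f\left(x^{(h)}\right)$$ exists for all $h=1,\ldots,n$. Let $\mu$ be a Borel probability measure on $X$ for which $x^{(1)},\ldots,x^{(n)}\in\operatorname{supp}(\mu)$. Suppose further that $$D_h=\lim_{k\to\infty}\frac{\mu\left(B\left(x^{(h)};r_k^{(h)}\right)\right)}{\mu\left(B\left(x^{(1)};r_k^{(1)}\right)\right)+\cdots+\mu\left(B\left(x^{(n)};r_k^{(n)}\right)\right)}$$ exists for all $h=1,\ldots,n$. Then $$\lim_{k\to\infty}\alpha_{B(\bar x;\bar r_k)}\left(\operatorname{Avg}_{F_k}f\right)=\sum_{h=1}^nD_hC_h.$$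
   Context: $(X,\rho)$ is a compact metric space and $C(X)$ is the space of continuous functions $X\to\mathbb{C}$. $G$ is a discrete group and $T:G\curvearrowright X$ is a left action by homeomorphisms $(T_g)_{g\in G}$ ($T_{g_1}\circ T_{g_2}=T_{g_1g_2}$, $T_{1_G}=\mathrm{id}_X$) which are Hölder with modulus of Hölder continuity $(H,L)$: $H,L:G\to(0,\infty)$ are functions with $\rho(T_gx,T_gy)\le L(g)\cdot\rho(x,y)^{H(g)}$ for all $g\in G$, $x,y\in X$. $\mathbf F=(F_k)_{k=1}^\infty$ is a sequence of nonempty finite subsets of $G$, and $n$ is a positive integer. For a finite nonempty $F\subseteq G$ and $f:X\to\mathbb{C}$, $\operatorname{Avg}_Ff:=\frac1{|F|}\sum_{g\in F}f\circ T_g$. The support of $\mu$ is denoted $\operatorname{supp}(\mu)$. For $x\in X,r>0$, $B(x;r)=\{y\in X:\rho(x,y)<r\}$; for $\bar x\in X^n$, $\bar r\in(0,\infty)^n$, $B(\bar x;\bar r):=\bigcup_{h=1}^nB(x^{(h)};r^{(h)})$. For a measurable $E\subseteq X$ with $\mu(E)>0$, $\alpha_E(f):=\frac1{\mu(E)}\int_Ef\,\mathrm d\mu$. A sequence $(\bar r_k)_{k=1}^\infty$ of $n$-tuples of positive numbers decays $(X,\rho,H,L,\mathbf F)$-fast if for all $h\in\{1,\ldots,n\}$ we have $\lim_{k\to\infty}r_k^{(h)}=0$ and, for all $\delta\in(0,\infty)$, $\lim_{k\to\infty}\frac{|\{g\in F_k:L(g)\cdot(r_k^{(h)})^{H(g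)}>\delta\}|}{|F_k|}=0$.
   Formalization: The points x^(1),…,x^(n) are assumed pairwise distinct; with repeated points the claimed formula can fail, e.g. for x=(a,a,b) in a two-point space with the trivial action and uniform measure. *)

theory Defs
  imports "HOL-Probability.Probability_Measure" "HOL-Algebra.Group_Action"
begin

text \<open>
  The compact metric space is a type of class \<open>metric_space\<close> whose universe is compact.
  Sequences indexed by \<open>k = 1, 2, \<dots>\<close> are functions on \<open>nat\<close> constrained only at \<open>k \<ge> 1\<close>, and
  \<open>n\<close>-tuples are functions on \<open>nat\<close> of which only the entries at \<open>1, \<dots>, n\<close> matter.
  A tuple of centres in the space has to consist of pairwise distinct points: a repeated centre is counted
  twice in the sum of the measures of the balls, but once in the measure of their union.
\<close>

definition homeo_action ::
    "('g, 'm) monoid_scheme \<Rightarrow> ('g \<Rightarrow> 'a \<Rightarrow> 'a::topological_space) \<Rightarrow> bool" where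
  "homeo_action G T \<longleftrightarrow>
     group_action G UNIV T \<and>
     (\<forall>g\<in>carrier G. \<exists>S. homeomorphism UNIV UNIV (T g) S)"

definition hoelder_action ::
    "('g, 'm) monoid_scheme \<Rightarrow> ('g \<Rightarrow> 'a \<Rightarrow> 'a::metric_space) \<Rightarrow> ('g \<Rightarrow> real) \<Rightarrow> ('g \<Rightarrow> real) \<Rightarrow> bool"
  where
  "hoelder_action G T H L \<longleftrightarrow>
     (\<forall>g\<in>carrier G. 0 < H g \<and> 0 < L g) \<and>
     (\<forall>g\<in>carrier G. \<forall>x y. dist (T g x) (T g y) \<le> L g * dist x y powr H g)"

definition Avg :: "('g \<Rightarrow> 'a \<Rightarrow> 'a) \<Rightarrow> 'g set \<Rightarrow> ('a \<Rightarrow> complex) \<Rightarrow> 'a \<Rightarrow> complex" where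
  "Avg T F f = (\<lambda>x. (\<Sum>g\<in>F. f (T g x)) / of_nat (card F))"

definition measure_support :: "'a::topological_space measure \<Rightarrow> 'a set" where
  "measure_support M = {x. \<forall>U. open U \<longrightarrow> x \<in> U \<longrightarrow> 0 < measure M U}"

definition multi_ball :: "nat \<Rightarrow> (nat \<Rightarrow> 'a::metric_space) \<Rightarrow> (nat \<Rightarrow> real) \<Rightarrow> 'a set" where
  "multi_ball n x r = (\<Union>h\<in>{1..n}. ball (x h) (r h))"

text \<open>Only meaningful for measurable \<open>E\<close> of positive measure.\<close>

definition set_average :: "'a measure \<Rightarrow> 'a set \<Rightarrow> ('a \<Rightarrow> complex) \<Rightarrow> complex" where
  "set_average M E f = (LINT y:E|M. f y) / of_real (measure M E)"

definition decays_fast ::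
    "('g \<Rightarrow> real) \<Rightarrow> ('g \<Rightarrow> real) \<Rightarrow> (nat \<Rightarrow> 'g set) \<Rightarrow> nat \<Rightarrow> (nat \<Rightarrow> nat \<Rightarrow> real) \<Rightarrow> bool" where
  "decays_fast H L F n r \<longleftrightarrow>
     (\<forall>h\<in>{1..n}.
        (\<lambda>k. r k h) \<longlonglongrightarrow> 0 \<and>
        (\<forall>\<delta>>0. (\<lambda>k. real (card {g \<in> F k. L g * r k h powr H g > \<delta>}) / real (card (F k)))
                 \<longlonglongrightarrow> 0))"

end

theory Submission
  imports Defs
begin

text \<open>
  As \<open>f\<close> is uniformly continuous and bounded, fast decay makes \<open>Avg T (F k) f\<close> uniformly close on the
  ball around \<open>x h\<close> to its value at \<open>x h\<close>: the group elements that do not map this ball into a small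
  set have vanishing proportion in \<open>F k\<close>. For large \<open>k\<close> the balls are disjoint, so the average over
  their union is close to the convex combination of the values at the centres, weighted by the relative
  measures of the balls.
\<close>

text \<open>Splitting \<open>F\<close> at the threshold \<delta> gives the two terms: an element
  \<open>g\<close> with \<open>L g * r powr H g\<close> at most \<delta> sends \<open>y\<close> and
  \<open>z\<close> to points within \<delta> of each other, and any other element costs at most
  \<open>2 * M\<close>. Only \<open>r\<close> enters the bound, so it is uniform in \<open>y\<close>
  over a ball around \<open>z\<close>.\<close>

lemma norm_Avg_diff_le:
  fixes f :: "'a::metric_space \<Rightarrow> complex"
  assumes T: "hoelder_action G T H L"
    and F: "finite F" "F \<noteq> {}" "F \<subseteq> carrier G"
    and f: "\<And>u v. dist u v \<le> \<delta> \<Longrightarrow> norm (f u - f v) \<le> \<epsilon>" "\<And>u. norm (f u) \<le> M"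
    and \<epsilon>: "0 \<le> \<epsilon>" and y: "dist y z \<le> r"
  shows "norm (Avg T F f y - Avg T F f z)
           \<le> \<epsilon> + 2 * M * (real (card {g \<in> F. L g * r powr H g > \<delta>}) / real (card F))"
proof -
  let ?B = "{g \<in> F. L g * r powr H g > \<delta>}"
  have c: "real (card F) > 0"
    using F by (simp add: card_gt_0_iff)
  have summand: "norm (f (T g y) - f (T g z)) \<le> \<epsilon> + (if g \<in> ?B then 2 * M else 0)" if "g \<in> F" for g
  proof (cases "g \<in> ?B")
    case True
    have "norm (f (T g y) - f (T g z)) \<le> norm (f (T g y)) + norm (f (T g z))"
      by (rule norm_triangle_ineq4)
    also have "\<dots> \<le> 2 * M"
      using f(2)[of "T g y"] f(2)[of "T g z"] by linarith
    finally show ?thesis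
      using True \<epsilon> by simp
  next
    case False
    have g: "0 < H g" "0 < L g" "dist (T g y) (T g z) \<le> L g * dist y z powr H g"
      using T F that by (auto simp: hoelder_action_def)
    \<comment> \<open>The exponent is positive, so \<open>powr\<close> is monotone and
      \<open>r\<close> may replace the distance; lying outside \<open>?B\<close> then gives the
      bound by \<delta>.\<close>
    have "L g * dist y z powr H g \<le> L g * r powr H g"
      using g y by (intro mult_left_mono powr_mono2) auto
    also have "\<dots> \<le> \<delta>"
      using False that by simp
    finally have "dist (T g y) (T g z) \<le> \<delta>"
      using g by linarith
    then show ?thesis
      using f(1)[of "T g y" "T g z"] False by (simp only: if_False add_0_right)
  qed
  have "norm (\<Sum>g\<in>F. f (T g y) - f (T g z)) \<le> (\<Sum>g\<in>F. \<epsilon> + (if g \<in> ?B then 2 * M else 0))"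
    by (intro sum_norm_le summand)
  also have "\<dots> = real (card F) * \<epsilon> + 2 * M * real (card ?B)"
    using F by (simp add: sum.distrib sum.If_cases Int_def)
  finally have "norm (\<Sum>g\<in>F. f (T g y) - f (T g z)) / real (card F)
      \<le> (real (card F) * \<epsilon> + 2 * M * real (card ?B)) / real (card F)"
    using c by (intro divide_right_mono) auto
  also have "\<dots> = \<epsilon> + 2 * M * (real (card ?B) / real (card F))"
    using c by (simp add: field_simps)
  finally show ?thesis
    by (simp add: Avg_def sum_subtractf norm_divide flip: diff_divide_distrib)
qed

text \<open>Compactness gives \<open>f\<close> a bound and a uniform modulus of continuity, the two
  inputs of \<open>norm_Avg_diff_le\<close>. A single centre with its own radii is treated, so that
  the result applies to each coordinate of the tuple.\<close>

lemma eventually_Avg_close_on_ball: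
  fixes f :: "'a::metric_space \<Rightarrow> complex"
  assumes X: "compact (UNIV :: 'a set)"
    and T: "hoelder_action G T H L"
    and F: "\<forall>\<^sub>F k in sequentially. F k \<noteq> {} \<and> finite (F k) \<and> F k \<subseteq> carrier G"
    and f: "continuous_on UNIV f"
    and decay: "\<And>\<delta>. \<delta> > 0 \<Longrightarrow>
      (\<lambda>k. real (card {g \<in> F k. L g * r k powr H g > \<delta>}) / real (card (F k))) \<longlonglongrightarrow> 0"
    and \<epsilon>: "\<epsilon> > 0"
  shows "\<forall>\<^sub>F k in sequentially. \<forall>y\<in>ball z (r k). norm (Avg T (F k) f y - Avg T (F k) f z) \<le> \<epsilon>"
proof -
  have "bounded (range f)"
    using X f by (intro compact_imp_bounded compact_continuous_image)
  then obtain M where M: "\<And>u. norm (f u) \<le> M"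
    by (auto simp: bounded_iff)
  have "uniformly_continuous_on UNIV f"
    using X f by (intro compact_uniformly_continuous)
  then obtain d where d: "d > 0" "\<And>u v. dist u v < d \<Longrightarrow> dist (f u) (f v) < \<epsilon> / 2"
    using \<epsilon> unfolding uniformly_continuous_on_def by (metis UNIV_I half_gt_zero)
  \<comment> \<open>Halving \<open>d\<close> turns the strict inequality of uniform continuity into
    the non-strict one complementary to the set counted by \<open>?q\<close>.\<close>
  have d2: "norm (f u - f v) \<le> \<epsilon> / 2" if "dist u v \<le> d / 2" for u v
    using d(2)[of u v] d(1) that by (simp add: dist_norm)
  let ?q = "\<lambda>k. real (card {g \<in> F k. L g * r k powr H g > d / 2}) / real (card (F k))"
  have "(\<lambda>k. 2 * M * ?q k) \<longlonglongrightarrow> 2 * M * 0"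
    using d(1) by (intro tendsto_mult tendsto_const decay) auto
  then have "\<forall>\<^sub>F k in sequentially. 2 * M * ?q k < \<epsilon> / 2"
    using \<epsilon> by (intro order_tendstoD(2)) auto
  with F show ?thesis
  proof eventually_elim
    case (elim k)
    show ?case
    proof
      fix y assume "y \<in> ball z (r k)"
      then have "dist y z \<le> r k"
        by (simp add: dist_commute)
      then have "norm (Avg T (F k) f y - Avg T (F k) f z) \<le> \<epsilon> / 2 + 2 * M * ?q k"
        using elim \<epsilon> M d2 by (intro norm_Avg_diff_le[OF T]) auto
      then show "norm (Avg T (F k) f y - Avg T (F k) f z) \<le> \<epsilon>"
        using elim by linarith
    qed
  qed
qed

text \<open>By disjointness, the measure of the union and the integral over it are sums over the
  pieces. Each piece contributes an error of at most \<open>e\<close> times its measure, and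
  division by the total measure leaves \<open>e\<close>. Comparing integrals instead of averages on
  the pieces covers pieces of measure zero.\<close>

lemma (in finite_measure) norm_set_average_Union_diff_le:
  fixes \<phi> :: "'a \<Rightarrow> complex"
  assumes I: "finite I" "disjoint_family_on B I" "\<And>i. i \<in> I \<Longrightarrow> B i \<in> sets M"
    and pos: "(\<Sum>i\<in>I. measure M (B i)) > 0"
    and int: "integrable M \<phi>"
    and e: "\<And>i y. i \<in> I \<Longrightarrow> y \<in> B i \<Longrightarrow> norm (\<phi> y - c i) \<le> e"
  shows "norm (set_average M (\<Union>i\<in>I. B i) \<phi>
           - (\<Sum>i\<in>I. of_real (measure M (B i) / (\<Sum>j\<in>I. measure M (B j))) * c i)) \<le> e"
proof -
  define S where "S = (\<Sum>j\<in>I. measure M (B j))"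
  have si: "set_integrable M (B i) \<phi>" if "i \<in> I" for i
    using int I that unfolding set_integrable_def by (intro integrable_mult_indicator)
  have const: "set_integrable M (B i) (\<lambda>_. d)" if "i \<in> I" for i and d :: complex
    using I that unfolding set_integrable_def by (intro integrable_mult_indicator) auto
  have mU: "measure M (\<Union>i\<in>I. B i) = S"
    unfolding S_def using I by (intro finite_measure_finite_Union) auto
  have iU: "(LINT y:(\<Union>i\<in>I. B i)|M. \<phi> y) = (\<Sum>i\<in>I. LINT y:B i|M. \<phi> y)"
    using I si by (intro set_integral_finite_Union) auto
  have piece: "norm ((LINT y:B i|M. \<phi> y) - of_real (measure M (B i)) * c i) \<le> e * measure M (B i)"
    if i: "i \<in> I" for i
  proof -
    have cc: "(LINT y:B i|M. c i) = of_real (measure M (B i)) * c i"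
      using I(3)[OF i] by (simp add: set_lebesgue_integral_def scaleR_conv_of_real)
    have "(LINT y:B i|M. \<phi> y) - of_real (measure M (B i)) * c i = (LINT y:B i|M. \<phi> y - c i)"
      unfolding cc[symmetric] using si[OF i] const[OF i] by (simp add: set_integral_diff)
    \<comment> \<open>The integrands compare pointwise: on \<open>B i\<close> by the assumption on
      \<open>c i\<close>, and off \<open>B i\<close> because both vanish.\<close>
    also have "norm \<dots> \<le> (LINT y|M. indicator (B i) y * e)"
      unfolding set_lebesgue_integral_def
    proof (rule order_trans[OF integral_norm_bound integral_mono])
      show "integrable M (\<lambda>y. norm (indicator (B i) y *\<^sub>R (\<phi> y - c i)))"
        using set_integral_diff(1)[OF si[OF i] const[OF i]]
        by (intro integrable_norm) (simp add: set_integrable_def)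
      show "integrable M (\<lambda>y. indicator (B i) y * e)"
        using I(3)[OF i] by (intro integrable_mult_left) (auto simp: emeasure_finite less_top[symmetric])
    qed (use e i in \<open>auto simp: indicator_def\<close>)
    also have "\<dots> = e * measure M (B i)"
      using I(3)[OF i] by simp
    finally show ?thesis .
  qed
  have "set_average M (\<Union>i\<in>I. B i) \<phi> - (\<Sum>i\<in>I. of_real (measure M (B i) / S) * c i)
      = (\<Sum>i\<in>I. (LINT y:B i|M. \<phi> y) - of_real (measure M (B i)) * c i) / of_real S"
    by (simp add: set_average_def mU iU sum_subtractf diff_divide_distrib sum_divide_distrib)
  also have "norm \<dots> \<le> (\<Sum>i\<in>I. e * measure M (B i)) / S"
    using pos piece
    by (auto simp: norm_divide simp flip: S_def intro!: divide_right_mono sum_norm_le)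
  also have "\<dots> = e"
    using pos by (simp add: S_def flip: sum_distrib_left)
  finally show ?thesis
    by (simp add: S_def)
qed

text \<open>Distinct centres have positive distance, and the sum of two radii tending to 0
  eventually falls below it; there are only finitely many pairs.\<close>

lemma eventually_disjoint_balls:
  fixes x :: "'i \<Rightarrow> 'a::metric_space"
  assumes I: "finite I" "inj_on x I" and r: "\<And>i. i \<in> I \<Longrightarrow> ((\<lambda>k. r k i) \<longlongrightarrow> 0) A"
  shows "\<forall>\<^sub>F k in A. disjoint_family_on (\<lambda>i. ball (x i) (r k i)) I"
proof -
  have "\<forall>\<^sub>F k in A. i \<noteq> j \<longrightarrow> ball (x i) (r k i) \<inter> ball (x j) (r k j) = {}"
    if "i \<in> I" "j \<in> I" for i j
  proof (cases "i = j")
    case False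
    then have "dist (x i) (x j) > 0"
      using I that by (auto dest: inj_onD)
    moreover have "((\<lambda>k. r k i + r k j) \<longlongrightarrow> 0) A"
      using tendsto_add[OF r r] that by fastforce
    ultimately have "\<forall>\<^sub>F k in A. r k i + r k j < dist (x i) (x j)"
      by (intro order_tendstoD(2))
    then show ?thesis
    proof eventually_elim
      case (elim k)
      then show ?case
        by (intro impI disjoint_ballI) simp
    qed
  qed simp
  then show ?thesis
    using I(1) by (simp add: disjoint_family_on_def eventually_ball_finite)
qed

theorem theorem2p13:
  fixes G :: "('g, 'm) monoid_scheme"
    and T :: "'g \<Rightarrow> 'a \<Rightarrow> 'a::metric_space"
    and H L :: "'g \<Rightarrow> real"
    and F :: "nat \<Rightarrow> 'g set"
    and n :: nat
    and r :: "nat \<Rightarrow> nat \<Rightarrow> real"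
    and f :: "'a \<Rightarrow> complex"
    and x :: "nat \<Rightarrow> 'a"
    and C :: "nat \<Rightarrow> complex"
    and D :: "nat \<Rightarrow> real"
    and \<mu> :: "'a measure"
  assumes "compact (UNIV :: 'a set)"
    and "group G"
    and "homeo_action G T"
    and "hoelder_action G T H L"
    and "\<And>k. k \<ge> 1 \<Longrightarrow> F k \<noteq> {} \<and> finite (F k) \<and> F k \<subseteq> carrier G"
    and "n \<ge> 1"
    and "\<And>k h. k \<ge> 1 \<Longrightarrow> h \<in> {1..n} \<Longrightarrow> r k h > 0"
    and "decays_fast H L F n r"
    and "continuous_on UNIV f"
    and "inj_on x {1..n}"
    and "\<And>h. h \<in> {1..n} \<Longrightarrow> (\<lambda>k. Avg T (F k) f (x h)) \<longlonglongrightarrow> C h"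
    and "prob_space \<mu>"
    and "sets \<mu> = sets borel"
    and "\<And>h. h \<in> {1..n} \<Longrightarrow> x h \<in> measure_support \<mu>"
    and "\<And>h. h \<in> {1..n} \<Longrightarrow>
           (\<lambda>k. measure \<mu> (ball (x h) (r k h)) / (\<Sum>j=1..n. measure \<mu> (ball (x j) (r k j))))
             \<longlonglongrightarrow> D h"
  shows "(\<lambda>k. set_average \<mu> (multi_ball n x (r k)) (Avg T (F k) f))
           \<longlonglongrightarrow> (\<Sum>h=1..n. of_real (D h) * C h)"
proof -
  interpret prob_space \<mu> by fact
  let ?B = "\<lambda>k h. ball (x h) (r k h)"
  let ?A = "\<lambda>k. Avg T (F k) f"
  let ?m = "\<lambda>k h. measure \<mu> (?B k h)"
  \<comment> \<open>\<open>W\<close> is the expected limit before passing to it, with the weights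
    and the averages at the centres taken at stage \<open>k\<close>. It remains to compare the set
    average with \<open>W\<close> and to let \<open>W\<close> converge.\<close>
  define W where "W k = (\<Sum>h=1..n. of_real (?m k h / (\<Sum>j=1..n. ?m k j)) * ?A k (x h))" for k
  have ev1: "\<forall>\<^sub>F k :: nat in sequentially. k \<ge> 1"
    by (rule eventually_ge_at_top)
  have "bounded (range f)"
    using assms(1,9) by (intro compact_imp_bounded compact_continuous_image)
  then obtain M where M: "\<And>u. norm (f u) \<le> M"
    by (auto simp: bounded_iff)
  have fT: "integrable \<mu> (\<lambda>y. f (T g y))" if "g \<in> carrier G" for g
  proof (rule integrable_const_bound[where B = M])
    have "continuous_on UNIV (T g)"
      using assms(3) that by (auto simp: homeo_action_def homeomorphism_def)
    then have "(\<lambda>y. f (T g y)) \<in> borel_measurable borel"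
      using continuous_on_compose2[OF assms(9)] by (intro borel_measurable_continuous_onI) auto
    then show "(\<lambda>y. f (T g y)) \<in> borel_measurable \<mu>"
      using measurable_cong_sets[OF assms(13) refl] by blast
  qed (simp add: M)
  have int: "integrable \<mu> (?A k)" if "k \<ge> 1" for k
    unfolding Avg_def using assms(5)[OF that] fT
    by (intro integrable_divide Bochner_Integration.integrable_sum) auto
  \<comment> \<open>Each ball is an open neighbourhood of a point of the support, and
    \<open>n \<ge> 1\<close> makes the sum nonempty.\<close>
  have pos: "(\<Sum>h=1..n. ?m k h) > 0" if "k \<ge> 1" for k
    using assms(6,7,14) that by (intro sum_pos) (auto simp: measure_support_def)
  have "(\<lambda>k. set_average \<mu> (multi_ball n x (r k)) (?A k) - W k) \<longlonglongrightarrow> 0"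
  proof (rule tendstoI)
    fix e :: real assume "e > 0"
    \<comment> \<open>The bound \<open>e / 2\<close> leaves room for the strict inequality in the
      definition of the limit.\<close>
    then have close: "\<forall>\<^sub>F k in sequentially. \<forall>y\<in>?B k h. norm (?A k y - ?A k (x h)) \<le> e / 2"
      if "h \<in> {1..n}" for h
      using assms(8) that eventually_mono[OF ev1 assms(5)]
      by (intro eventually_Avg_close_on_ball[OF assms(1,4) _ assms(9)]) (auto simp: decays_fast_def)
    then have "\<forall>\<^sub>F k in sequentially. \<forall>h\<in>{1..n}. \<forall>y\<in>?B k h. norm (?A k y - ?A k (x h)) \<le> e / 2"
      by (intro eventually_ball_finite) auto
    \<comment> \<open>Distinctness of the centres enters here: once the balls are disjoint, the
      denominator of the weights is the measure of their union.\<close>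
    moreover have "\<forall>\<^sub>F k in sequentially. disjoint_family_on (?B k) {1..n}"
      using assms(8,10) by (intro eventually_disjoint_balls) (auto simp: decays_fast_def)
    ultimately show
      "\<forall>\<^sub>F k in sequentially. dist (set_average \<mu> (multi_ball n x (r k)) (?A k) - W k) 0 < e"
      using ev1
    proof eventually_elim
      case (elim k)
      have "norm (set_average \<mu> (\<Union>h\<in>{1..n}. ?B k h) (?A k) - W k) \<le> e / 2"
        unfolding W_def using elim pos int
        by (intro norm_set_average_Union_diff_le) (auto simp: assms(13))
      then show ?case
        using \<open>e > 0\<close> by (simp add: multi_ball_def)
    qed
  qed
  \<comment> \<open>In each summand the weight tends to \<open>D h\<close> and the average at the
    centre to \<open>C h\<close>.\<close>
  moreover have "W \<longlonglongrightarrow> (\<Sum>h=1..n. of_real (D h) * C h)"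
    unfolding W_def by (intro tendsto_sum tendsto_mult tendsto_of_real assms(11,15))
  ultimately show ?thesis
    by (rule Lim_transform[rotated])
qed

end
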